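(* Let $K$ be a field. Every non-zero $K$-derivation of degree less than or equal to $1$ on $K[x,y]$ is integrable.
   Context: A $K$-derivation on $K[x,y]$ is a map $d\colon K[x,y]\to K[x,y]$ that is additive, vanishes on $K$, and satisfies the Leibniz rule. The degree of $d$ is the maximum of the total degrees of the polynomials $d(x)$ and $d(y)$. A non-zero $K$-derivation $d$ on $K[x,y]$ is called integrable if there exists a $K$-derivation $\delta$ on $K[x,y]$ that commutes with $d$ (that is, $d(\delta(a))=\delta(d(a))$ for all $a\in K[x,y]$) and such that $d$ and $\delta$ are linearly independent over $K(x,y)$. *)

theory Defs
  imports "HOL-Computational_Algebra.Computational_Algebra"
begin

text \<open>
  The ring \<open>K[x,y]\<close> is represented as \<open>K[x][y]\<close>, i.e. as the type \<open>'a poly poly\<close>: the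
  coefficient of \<open>x\<^sup>i y\<^sup>j\<close> in \<open>p\<close> is \<open>coeff (coeff p j) i\<close>. Its field of fractions
  \<open>K(x,y)\<close> is \<open>'a poly poly fract\<close>.
\<close>

type_synonym 'a poly2 = "'a poly poly"

definition const2 :: "'a::comm_ring_1 \<Rightarrow> 'a poly2" where
  "const2 c = [:[:c:]:]"

definition var_x :: "'a::comm_ring_1 poly2" where
  "var_x = [:[:0, 1:]:]"

definition var_y :: "'a::comm_ring_1 poly2" where
  "var_y = [:0, 1:]"

text \<open>The zero polynomial is given total degree \<open>0\<close>.\<close>

definition total_degree :: "'a::comm_ring_1 poly2 \<Rightarrow> nat" where
  "total_degree p = Max (insert 0 {i + j | i j. coeff (coeff p j) i \<noteq> 0})"

definition K_derivation :: "('a::field poly2 \<Rightarrow> 'a poly2) \<Rightarrow> bool" where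
  "K_derivation d \<longleftrightarrow>
     (\<forall>f g. d (f + g) = d f + d g) \<and>
     (\<forall>c. d (const2 c) = 0) \<and>
     (\<forall>f g. d (f * g) = d f * g + f * d g)"

definition derivation_degree :: "('a::field poly2 \<Rightarrow> 'a poly2) \<Rightarrow> nat" where
  "derivation_degree d = max (total_degree (d var_x)) (total_degree (d var_y))"

text \<open>
  Linear independence over \<open>K(x,y)\<close> of the two-element family \<open>(d, e)\<close> in the
  \<open>K(x,y)\<close>-vector space of maps from \<open>K[x,y]\<close> to \<open>K(x,y)\<close>.
\<close>

definition lin_indep_over_fract ::
    "('a::field poly2 \<Rightarrow> 'a poly2) \<Rightarrow> ('a poly2 \<Rightarrow> 'a poly2) \<Rightarrow> bool" where
  "lin_indep_over_fract d e \<longleftrightarrow>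
     (\<forall>(a :: 'a poly2 fract) (b :: 'a poly2 fract).
        (\<forall>f. a * to_fract (d f) + b * to_fract (e f) = 0) \<longrightarrow> a = 0 \<and> b = 0)"

definition integrable_derivation :: "('a::field poly2 \<Rightarrow> 'a poly2) \<Rightarrow> bool" where
  "integrable_derivation d \<longleftrightarrow>
     K_derivation d \<and> d \<noteq> (\<lambda>_. 0) \<and>
     (\<exists>\<delta>. K_derivation \<delta> \<and> (\<forall>f. d (\<delta> f) = \<delta> (d f)) \<and> lin_indep_over_fract d \<delta>)"

lemma finite_total_degree_support: "finite {i + j | i j. coeff (coeff p j) i \<noteq> 0}"
proof -
  have "{i + j | i j. coeff (coeff p j) i \<noteq> 0} \<subseteq>
        (\<lambda>(i, j). i + j) ` (SIGMA j:{..degree p}. {..degree (coeff p j)})"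
    by (force simp: image_iff add.commute intro: le_degree)
  then show ?thesis
    by (rule finite_subset) auto
qed

lemma total_degree_le_iff:
  "total_degree p \<le> n \<longleftrightarrow> (\<forall>i j. coeff (coeff p j) i \<noteq> 0 \<longrightarrow> i + j \<le> n)"
  unfolding total_degree_def by (subst Max_le_iff) (auto intro: finite_total_degree_support)

end

theory Submission
  imports Defs
begin

text \<open>
  Write \<open>d x = f\<close>, \<open>d y = g\<close> as the affine map \<open>w = A z + v\<close> in \<open>z = (x, y)\<close>. A derivation with
  \<open>\<delta> x = P\<close>, \<open>\<delta> y = Q\<close> commutes with \<open>d\<close> iff \<open>d (P, Q) = A (P, Q)\<close>, and is independent of \<open>d\<close> iff
  \<open>f Q - g P \<noteq> 0\<close>. If \<open>A\<close> is invertible and not scalar, \<open>(P, Q) = A w\<close> works; if \<open>A\<close> is a nonzero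
  scalar, \<open>(P, Q) = (f, 0)\<close> works. If \<open>A\<close> is singular, a constant vector \<open>n\<close> in its kernel commutes,
  and it is independent of \<open>d\<close> unless \<open>w\<close> is a multiple of \<open>n\<close>. This can be avoided by choice of \<open>n\<close>
  if \<open>A = 0\<close>; otherwise it means \<open>A w = 0\<close>, so that \<open>A\<close> is nilpotent and a suitably translated
  Euler field \<open>z + m\<close> works.
\<close>

lemma K_derivation_add: "K_derivation d \<Longrightarrow> d (f + g) = d f + d g"
  and K_derivation_const: "K_derivation d \<Longrightarrow> d (const2 c) = 0"
  and K_derivation_mult: "K_derivation d \<Longrightarrow> d (f * g) = d f * g + f * d g"
  unfolding K_derivation_def by blast+

lemma K_derivation_const_mult: "K_derivation d \<Longrightarrow> d (const2 c * f) = const2 c * d f"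
  by (simp add: K_derivation_mult K_derivation_const)

lemma K_derivation_zero: "K_derivation d \<Longrightarrow> d 0 = 0"
  using K_derivation_const[of d 0] by (simp add: const2_def)

lemma const2_pCons: "[:pCons c p:] = const2 c + var_x * [:p:]"
  by (simp add: const2_def var_x_def)

lemma pCons_var_y: "pCons p f = [:p:] + var_y * f" for f :: "'a::comm_ring_1 poly2"
  by (simp add: var_y_def)

text \<open>Constants and the two variables generate the ring, so an induction on the powers of
  \<open>var_y\<close>, and inside it one on the powers of \<open>var_x\<close>, suffices. Applied
  to a commutator, this reduces commutation to a check on the variables.\<close>

lemma K_derivation_eq_0:
  assumes D: "K_derivation D" and x: "D var_x = 0" and y: "D var_y = 0"
  shows "D f = 0"
proof (induction f)
  case 0
  show ?case by (rule K_derivation_zero[OF D])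
next
  case (pCons p f)
  have "D [:p:] = 0"
  proof (induction p)
    case 0
    show ?case by (simp add: K_derivation_zero[OF D])
  next
    case (pCons c p)
    then show ?case
      unfolding const2_pCons
      by (simp only: K_derivation_add[OF D] K_derivation_mult[OF D] K_derivation_const[OF D] x) simp
  qed
  with pCons.IH show ?case
    unfolding pCons_var_y[of p f]
    by (simp only: K_derivation_add[OF D] K_derivation_mult[OF D] y) simp
qed

text \<open>The mixed terms \<open>d f * e g\<close> and \<open>e f * d g\<close> of the product
  rule occur in both compositions and cancel.\<close>

lemma K_derivation_commutator:
  assumes d: "K_derivation d" and e: "K_derivation e"
  shows "K_derivation (\<lambda>f. d (e f) - e (d f))"
  unfolding K_derivation_def
  by (auto simp: K_derivation_add[OF d] K_derivation_mult[OF d] K_derivation_const[OF d]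
      K_derivation_add[OF e] K_derivation_mult[OF e] K_derivation_const[OF e]
      K_derivation_zero[OF d] K_derivation_zero[OF e] algebra_simps)

text \<open>Since \<open>var_x\<close> lives in the coefficients, \<open>map_poly pderiv\<close> is
  the partial derivative in x, and the outer \<open>pderiv\<close> is the one in y.\<close>

definition vector_field :: "'a::field poly2 \<Rightarrow> 'a poly2 \<Rightarrow> 'a poly2 \<Rightarrow> 'a poly2" where
  "vector_field P Q f = P * map_poly pderiv f + Q * pderiv f"

lemma map_poly_pderiv_add:
  "map_poly pderiv (f + g) = map_poly pderiv f + map_poly pderiv g" for f g :: "'a::field poly2"
  by (intro poly_eqI) (simp add: coeff_map_poly pderiv_add)

lemma pderiv_sum: "pderiv (\<Sum>i\<in>S. h i) = (\<Sum>i\<in>S. pderiv (h i))" for h :: "'b \<Rightarrow> 'a::field poly"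
  by (induction S rule: infinite_finite_induct) (auto simp: pderiv_add)

lemma map_poly_pderiv_mult:
  "map_poly pderiv (f * g) = map_poly pderiv f * g + f * map_poly pderiv g"
  for f g :: "'a::field poly2"
  by (intro poly_eqI)
    (simp add: coeff_map_poly coeff_mult pderiv_sum pderiv_mult sum.distrib, simp add: ac_simps)

lemma K_derivation_vector_field: "K_derivation (vector_field P Q)"
  unfolding K_derivation_def vector_field_def
  by (auto simp: map_poly_pderiv_add map_poly_pderiv_mult pderiv_add pderiv_mult const2_def
      map_poly_pCons pderiv_pCons algebra_simps)

lemma vector_field_var_x: "vector_field P Q var_x = P"
  by (simp add: vector_field_def var_x_def map_poly_pCons pderiv_pCons one_pCons[symmetric])

lemma vector_field_var_y: "vector_field P Q var_y = Q"
  by (simp add: vector_field_def var_y_def map_poly_pCons pderiv_pCons)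

text \<open>Cramer's rule: a linear relation, tested on the two variables only, is a 2 by 2 system
  whose determinant is the given nonzero polynomial.\<close>

lemma lin_indep_over_fractI:
  assumes "d var_x * e var_y - d var_y * e var_x \<noteq> 0"
  shows "lin_indep_over_fract d e"
  unfolding lin_indep_over_fract_def
proof (intro allI impI)
  fix a b :: "'a poly2 fract"
  assume *: "\<forall>f. a * to_fract (d f) + b * to_fract (e f) = 0"
  let ?f = "to_fract (d var_x)" and ?g = "to_fract (d var_y)"
  let ?P = "to_fract (e var_x)" and ?Q = "to_fract (e var_y)"
  have x: "a * ?f + b * ?P = 0" and y: "a * ?g + b * ?Q = 0"
    using * by blast+
  have nz: "?f * ?Q - ?g * ?P \<noteq> 0"
    using assms by (metis to_fract_diff to_fract_mult to_fract_eq_0_iff)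
  have "a * (?f * ?Q - ?g * ?P) = (a * ?f + b * ?P) * ?Q - (a * ?g + b * ?Q) * ?P"
    by (simp add: algebra_simps)
  moreover have "b * (?f * ?Q - ?g * ?P) = (a * ?g + b * ?Q) * ?f - (a * ?f + b * ?P) * ?g"
    by (simp add: algebra_simps)
  ultimately show "a = 0 \<and> b = 0"
    using x y nz by simp
qed

definition affine2 :: "'a::comm_ring_1 \<Rightarrow> 'a \<Rightarrow> 'a \<Rightarrow> 'a poly2" where
  "affine2 a b c = const2 a * var_x + const2 b * var_y + const2 c"

lemma affine2_pCons: "affine2 a b c = [:[:c, a:], [:b:]:]"
  by (simp add: affine2_def const2_def var_x_def var_y_def)

lemma affine2_eq_0_iff: "affine2 a b c = 0 \<longleftrightarrow> a = 0 \<and> b = 0 \<and> c = 0"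
  by (auto simp: affine2_pCons)

lemma total_degree_le_1E:
  assumes "total_degree p \<le> 1"
  obtains a b c where "p = affine2 a b c"
proof
  have z: "coeff (coeff p j) i = 0" if "i + j > 1" for i j
    using assms that unfolding total_degree_le_iff by fastforce
  show "p = affine2 (coeff (coeff p 0) 1) (coeff (coeff p 1) 0) (coeff (coeff p 0) 0)"
    unfolding affine2_pCons
    by (intro poly_eqI) (auto simp: coeff_pCons z split: nat.split)
qed

text \<open>\<open>P\<close> and \<open>Q\<close> are the values of the second derivation on the
  variables. It kills the constants \<open>c\<close> and \<open>r\<close>, so only the linear part
  of \<open>d\<close> enters the commutation conditions.\<close>

lemma integrable_derivationI:
  assumes d: "K_derivation d"
    and x: "d var_x = affine2 a b c" and y: "d var_y = affine2 p q r"
    and P: "d P = const2 a * P + const2 b * Q" and Q: "d Q = const2 p * P + const2 q * Q"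
    and nz: "d var_x * Q - d var_y * P \<noteq> 0"
  shows "integrable_derivation d"
proof -
  let ?e = "vector_field P Q"
  note e = K_derivation_vector_field[of P Q]
  have lin: "?e (affine2 a b c) = const2 a * P + const2 b * Q" for a b c
    by (simp add: affine2_def K_derivation_add[OF e] K_derivation_const_mult[OF e]
        K_derivation_const[OF e] vector_field_var_x vector_field_var_y)
  have "d (?e f) - ?e (d f) = 0" for f
    by (rule K_derivation_eq_0[OF K_derivation_commutator[OF d e]])
      (simp_all add: vector_field_var_x vector_field_var_y x y P Q lin)
  moreover have "lin_indep_over_fract d ?e"
    by (rule lin_indep_over_fractI) (use nz in \<open>simp add: vector_field_var_x vector_field_var_y\<close>)
  moreover have "d \<noteq> (\<lambda>_. 0)"
    using nz by auto
  ultimately show ?thesis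
    unfolding integrable_derivation_def using d e by auto
qed

theorem proposition2p1:
  fixes d :: "'a::field poly2 \<Rightarrow> 'a poly2"
  assumes "K_derivation d" and "d \<noteq> (\<lambda>_. 0)" and "derivation_degree d \<le> 1"
  shows "integrable_derivation d"
proof -
  note d = assms(1)
  have "total_degree (d var_x) \<le> 1" "total_degree (d var_y) \<le> 1"
    using assms(3) by (auto simp: derivation_degree_def)
  then obtain a b c p q r where f: "d var_x = affine2 a b c" and g: "d var_y = affine2 p q r"
    by (metis total_degree_le_1E)
  note I = integrable_derivationI[OF d f g]
  have d_affine: "d (affine2 s t u) = const2 s * affine2 a b c + const2 t * affine2 p q r" for s t u
    by (simp add: affine2_def[of s t u] K_derivation_add[OF d] K_derivation_const_mult[OF d]
        K_derivation_const[OF d] f g)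
  have nz: "affine2 a b c \<noteq> 0 \<or> affine2 p q r \<noteq> 0"
    using K_derivation_eq_0[OF d] assms(2) f g by fastforce
  consider (inv) "a * q - b * p \<noteq> 0" "\<not> (b = 0 \<and> p = 0 \<and> a = q)"
    | (scalar) "a \<noteq> 0" "b = 0" "p = 0" "q = a"
    | (zero) "a = 0" "b = 0" "p = 0" "q = 0"
    | (sing) "a * q - b * p = 0" "\<not> (a = 0 \<and> b = 0 \<and> p = 0 \<and> q = 0)"
    by auto
  then show ?thesis
  proof cases
    case inv
    let ?f = "affine2 a b c" and ?g = "affine2 p q r"
    let ?P = "const2 a * ?f + const2 b * ?g" and ?Q = "const2 p * ?f + const2 q * ?g"
    \<comment> \<open>The determinant is shown to be nonzero by evaluating it at points of the plane
      over K.\<close>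
    define ev where "ev x y F = poly (poly F [:y:]) x" for x y :: 'a and F
    have ev_simps: "ev x y (F + G) = ev x y F + ev x y G" "ev x y (F - G) = ev x y F - ev x y G"
      "ev x y (F * G) = ev x y F * ev x y G" "ev x y (const2 s) = s" for x y F G s
      by (simp_all add: ev_def const2_def)
    have ev_affine: "ev x y (affine2 s t u) = s * x + t * y + u" for x y s t u
      by (simp add: ev_def affine2_pCons algebra_simps)
    show ?thesis
    proof (rule I)
      show "d ?P = const2 a * ?P + const2 b * ?Q" "d ?Q = const2 p * ?P + const2 q * ?Q"
        by (simp_all add: K_derivation_add[OF d] K_derivation_const_mult[OF d] d_affine)
      show "d var_x * ?Q - d var_y * ?P \<noteq> 0"
      proof
        assume *: "d var_x * ?Q - d var_y * ?P = 0"
        \<comment> \<open>The linear part is invertible, so \<open>d var_x\<close> and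
          \<open>d var_y\<close> take any prescribed values \<open>s\<close> and \<open>t\<close> at
          some point, given by Cramer's rule.\<close>
        have eq: "s * (p * s + q * t) - t * (a * s + b * t) = 0" for s t
        proof -
          let ?D = "a * q - b * p"
          let ?x = "(q * (s - c) - b * (t - r)) / ?D" and ?y = "(a * (t - r) - p * (s - c)) / ?D"
          have "a * (q * (s - c) - b * (t - r)) + b * (a * (t - r) - p * (s - c)) = ?D * (s - c)"
            by (simp add: algebra_simps)
          then have 1: "a * ?x + b * ?y + c = s"
            using inv(1) by (simp add: add_divide_distrib[symmetric])
          have "p * (q * (s - c) - b * (t - r)) + q * (a * (t - r) - p * (s - c)) = ?D * (t - r)"
            by (simp add: algebra_simps)
          then have 2: "p * ?x + q * ?y + r = t"
            using inv(1) by (simp add: add_divide_distrib[symmetric])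
          have "ev ?x ?y (d var_x * ?Q - d var_y * ?P) = 0"
            unfolding * by (simp add: ev_def)
          then show ?thesis
            unfolding f g ev_simps ev_affine 1 2 .
        qed
        \<comment> \<open>The form is \<open>p * s^2 + (q - a) * s * t - b * t^2\<close>; these
          three arguments, available over every field, isolate its coefficients.\<close>
        from eq[of 1 0] eq[of 0 1] eq[of 1 1] inv(2) show False
          by auto
      qed
    qed
  next
    case scalar
    show ?thesis
    proof (rule I)
      show "d (affine2 a b c) = const2 a * affine2 a b c + const2 b * 0"
        "d 0 = const2 p * affine2 a b c + const2 q * 0"
        using scalar by (simp_all add: d_affine const2_def K_derivation_zero[OF d])
      show "d var_x * 0 - d var_y * affine2 a b c \<noteq> 0"
        using scalar by (simp add: f g affine2_eq_0_iff)
    qed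
  next
    case zero
    have *: "integrable_derivation d" if "c * t - r * s \<noteq> 0" for s t
      by (rule I[of "const2 s" "const2 t"])
        (use zero that in \<open>simp_all add: f g affine2_pCons const2_def mult.commute
          K_derivation_const[OF d, unfolded const2_def]\<close>)
    from nz zero *[of 0 1] *[of 1 0] show ?thesis
      by (auto simp: affine2_eq_0_iff)
  next
    case sing
    show ?thesis
    \<comment> \<open>The condition is \<open>A w = 0\<close> in the notation of the
      overview.\<close>
    proof (cases "const2 a * affine2 a b c + const2 b * affine2 p q r = 0 \<and>
        const2 p * affine2 a b c + const2 q * affine2 p q r = 0")
      case False
      have *: "integrable_derivation d"
        if "a * s = b * t" "p * s = q * t"
          "const2 t * affine2 a b c + const2 s * affine2 p q r \<noteq> 0" for s t
      proof (rule I)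
        show "d (const2 s) = const2 a * const2 s + const2 b * const2 (- t)"
          "d (const2 (- t)) = const2 p * const2 s + const2 q * const2 (- t)"
          using that by (simp_all add: K_derivation_const[OF d]) (simp_all add: const2_def)
        have "d var_x * const2 (- t) - d var_y * const2 s
            = - (const2 t * affine2 a b c + const2 s * affine2 p q r)"
          by (simp add: f g affine2_pCons const2_def)
        then show "d var_x * const2 (- t) - d var_y * const2 s \<noteq> 0"
          using that(3) by (metis neg_equal_0_iff_equal)
      qed
      \<comment> \<open>The kernel vectors are \<open>(b, -a)\<close> and \<open>(q, -p)\<close>; up
        to sign, their determinants with \<open>w\<close> are the two entries of
        \<open>A w\<close>.\<close>
      from False *[of b a] *[of q p] sing(1) show ?thesis
        by (auto simp: mult.commute)
    next
      case True
      \<comment> \<open>Comparing coefficients in \<open>A w = 0\<close> gives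
        \<open>A A = 0\<close> and \<open>A v = 0\<close>.\<close>
      then have A2: "a * a + b * p = 0" "a * b + b * q = 0" "a * c + b * r = 0"
        "p * a + q * p = 0" "p * b + q * q = 0" "p * c + q * r = 0"
        by (auto simp: affine2_pCons const2_def)
      show ?thesis
      proof (cases "b = 0")
        case False
        have "b * (a + q) = 0" using A2(2) by (simp add: algebra_simps)
        then have q: "q = - a" using False by (simp add: eq_neg_iff_add_eq_0 add.commute)
        have p: "p = - (a * a / b)" using A2(1) False by (simp add: field_simps eq_neg_iff_add_eq_0)
        have r: "r = - (a * c / b)" using A2(3) False by (simp add: field_simps eq_neg_iff_add_eq_0)
        show ?thesis
        \<comment> \<open>The translation \<open>m = (0, c / b)\<close> solves
          \<open>A m = v\<close>, hence \<open>d (z + m) = w = A (z + m)\<close>.\<close>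
        proof (rule I)
          show "d (affine2 1 0 0) = const2 a * affine2 1 0 0 + const2 b * affine2 0 1 (c / b)"
            "d (affine2 0 1 (c / b)) = const2 p * affine2 1 0 0 + const2 q * affine2 0 1 (c / b)"
            using False by (simp_all only: d_affine) (simp_all add: affine2_pCons const2_def q p r)
          \<comment> \<open>Here \<open>d var_y\<close> is \<open>- a / b\<close> times
            \<open>d var_x\<close>, which makes the determinant a multiple of a square.\<close>
          have "d var_x * affine2 0 1 (c / b) - d var_y * affine2 1 0 0
            = const2 (1 / b) * affine2 a b c * affine2 a b c"
            using False by (simp add: f g affine2_pCons const2_def q p r field_simps)
          then show "d var_x * affine2 0 1 (c / b) - d var_y * affine2 1 0 0 \<noteq> 0"
            using False by (simp add: affine2_eq_0_iff const2_def)
        qed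
      next
        case True
        then have a: "a = 0" and q: "q = 0" using A2 by auto
        then have p: "p \<noteq> 0" and c: "c = 0" using A2 sing(2) True by auto
        show ?thesis
        \<comment> \<open>Now \<open>w = (0, p * x + r)\<close>, and \<open>m = (r / p, 0)\<close>
          solves \<open>A m = v\<close>.\<close>
        proof (rule I)
          show "d (affine2 1 0 (r / p)) = const2 a * affine2 1 0 (r / p) + const2 b * affine2 0 1 0"
            "d (affine2 0 1 0) = const2 p * affine2 1 0 (r / p) + const2 q * affine2 0 1 0"
            using p by (simp_all only: d_affine) (simp_all add: affine2_pCons const2_def q a c True)
          show "d var_x * affine2 0 1 0 - d var_y * affine2 1 0 (r / p) \<noteq> 0"
            using p by (simp add: f g a c True affine2_eq_0_iff) (simp add: affine2_pCons)
        qed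
      qed
    qed
  qed
qed

end
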